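(* The forward and the backward horocycles of the Hilbert disc $(\mathbb{D},F_H)$ are ellipses.
   Context: $\mathbb{D}=\{x\in\mathbb{R}^2:|x|<1\}$, with $|\cdot|$ and $\langle\cdot,\cdot\rangle$ the Euclidean norm and inner product. The Hilbert metric on $\mathbb{D}$ is $F_H(x,v)=\dfrac{\sqrt{(1-|x|^2)|v|^2+\langle x,v\rangle^2}}{1-|x|^2}$. Its distance is $d_H(x_1,x_2)=\dfrac12\ln\dfrac{|x_2-b|\,|x_1-a|}{|x_1-b|\,|x_2-a|}$ for $x_1\neq x_2$, where $a$ is the point at which the ray from $x_1$ through $x_2$ meets $\partial\mathbb{D}$ and $b$ is the point at which the ray from $x_2$ through $x_1$ meets $\partial\mathbb{D}$. The unit speed geodesic line $\beta$ with $\beta(0)=p\in\mathbb{D}$ and forward hitting point $y\in\partial\mathbb{D}$ is $\beta(t)=(1-s(t))p+s(t)y$, where $s(t)=\dfrac{e^t-e^{-t}}{e^t+k\,e^{-t}}$ and $k=\dfrac{|y-p|^2}{|y|^2-|p|^2}$. Its Busemann function is $b_\beta(x)=\lim_{t\to\infty}\{t-d_H(x,\beta(t))\}$. The forward horocycles along $\beta$ are the level sets $b_\beta^{-1}(a)\subset\mathbb{D}$, $a\in\mathbb{R}$, that is, the limits as $t\to\infty$ of the backward spheres $\{x\in\mathbb{D}: d_H(x,\beta(t))=t-a\}$. The backward horocycles are the analogous limits, as $t\to\infty$, of the forward spheres $\{x\in\mathbb{D}: d_H(\beta(-t),x)=t-a\}$. *)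

theory Defs
  imports "HOL-Analysis.Analysis"
begin

abbreviation disc :: "(real^2) set" where
  "disc \<equiv> ball 0 1"

text \<open>Where the ray from \<open>x\<^sub>1\<close> through \<open>x\<^sub>2\<close> meets the unit circle; this point is unique
  if \<open>x\<^sub>1\<close> lies in the open disc and \<open>x\<^sub>1 \<noteq> x\<^sub>2\<close>.\<close>

definition hit_point :: "real^2 \<Rightarrow> real^2 \<Rightarrow> real^2" where
  "hit_point x\<^sub>1 x\<^sub>2 = (THE a. a \<in> frontier disc \<and> (\<exists>r\<ge>0. a = x\<^sub>1 + r *\<^sub>R (x\<^sub>2 - x\<^sub>1)))"

definition hilbert_dist :: "real^2 \<Rightarrow> real^2 \<Rightarrow> real" where
  "hilbert_dist x\<^sub>1 x\<^sub>2 =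
     (if x\<^sub>1 = x\<^sub>2 then 0
      else let a = hit_point x\<^sub>1 x\<^sub>2; b = hit_point x\<^sub>2 x\<^sub>1
           in 1/2 * ln ((norm (x\<^sub>2 - b) * norm (x\<^sub>1 - a)) / (norm (x\<^sub>1 - b) * norm (x\<^sub>2 - a))))"

definition geodesic_param :: "real^2 \<Rightarrow> real^2 \<Rightarrow> real \<Rightarrow> real" where
  "geodesic_param p y t =
     (let k = (norm (y - p))\<^sup>2 / ((norm y)\<^sup>2 - (norm p)\<^sup>2)
      in (exp t - exp (- t)) / (exp t + k * exp (- t)))"

text \<open>The unit speed geodesic line through \<open>p\<close> (at time 0) with forward hitting point \<open>y\<close>.\<close>

definition geodesic :: "real^2 \<Rightarrow> real^2 \<Rightarrow> real \<Rightarrow> real^2" where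
  "geodesic p y t = (1 - geodesic_param p y t) *\<^sub>R p + geodesic_param p y t *\<^sub>R y"

definition busemann :: "(real \<Rightarrow> real^2) \<Rightarrow> real^2 \<Rightarrow> real" where
  "busemann \<beta> x = Lim at_top (\<lambda>t. t - hilbert_dist x (\<beta> t))"

definition forward_horocycle :: "(real \<Rightarrow> real^2) \<Rightarrow> real \<Rightarrow> (real^2) set" where
  "forward_horocycle \<beta> a = {x \<in> disc. busemann \<beta> x = a}"

definition forward_sphere :: "real^2 \<Rightarrow> real \<Rightarrow> (real^2) set" where
  "forward_sphere q r = {x \<in> disc. hilbert_dist q x = r}"

text \<open>Painleve-Kuratowski convergence \<open>S t \<longlongrightarrow> H\<close> as \<open>t \<longlongrightarrow> \<infinity>\<close>, relative to an ambient set \<open>U\<close>: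
  points of \<open>H\<close> are approached by all late \<open>S t\<close>, and every other point of \<open>U\<close> has a
  neighbourhood avoided by all late \<open>S t\<close>. The limit \<open>H\<close> is unique if it exists.\<close>

definition set_limit_in :: "'a::metric_space set \<Rightarrow> (real \<Rightarrow> 'a set) \<Rightarrow> 'a set \<Rightarrow> bool" where
  "set_limit_in U S H \<longleftrightarrow>
     H \<subseteq> U \<and>
     (\<forall>x\<in>H. \<forall>e>0. \<forall>\<^sub>F t in at_top. S t \<inter> ball x e \<noteq> {}) \<and>
     (\<forall>x\<in>U - H. \<exists>e>0. \<forall>\<^sub>F t in at_top. S t \<inter> ball x e = {})"

definition backward_horocycle :: "(real \<Rightarrow> real^2) \<Rightarrow> real \<Rightarrow> (real^2) set" where
  "backward_horocycle \<beta> a =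
     (THE H. set_limit_in disc (\<lambda>t. forward_sphere (\<beta> (- t)) (t - a)) H)"

text \<open>The ellipse with centre \<open>c\<close>, orthonormal axis directions \<open>u\<close>, \<open>v\<close> and
  semi-axes \<open>A\<close>, \<open>B\<close>; circles count as ellipses.\<close>

definition is_ellipse :: "(real^2) set \<Rightarrow> bool" where
  "is_ellipse E \<longleftrightarrow>
     (\<exists>c u v A B. norm u = 1 \<and> norm v = 1 \<and> u \<bullet> v = 0 \<and> A > 0 \<and> B > 0 \<and>
        E = {x. ((x - c) \<bullet> u)\<^sup>2 / A\<^sup>2 + ((x - c) \<bullet> v)\<^sup>2 / B\<^sup>2 = 1})"

end

theory Submission
  imports Defs "HOL-Real_Asymp.Real_Asymp"
begin

text \<open>
  In the projective model \<open>cosh d(x, q) = (1 - x \<bullet> q) / sqrt ((1 - \<bar>x\<bar>\<^sup>2) (1 - \<bar>q\<bar>\<^sup>2))\<close>. Along the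
  geodesic from \<open>z\<close> to \<open>y\<close> through \<open>p\<close> this becomes
  \<open>(e\<^sup>t (1 - x \<bullet> y) + e\<^sup>-\<^sup>t k (1 - x \<bullet> z)) / (m sqrt (1 - \<bar>x\<bar>\<^sup>2))\<close> with constants \<open>k\<close> and \<open>m\<close>, so
  that both kinds of horocycles are given by \<open>1 - x \<bullet> w = c sqrt (1 - \<bar>x\<bar>\<^sup>2)\<close> with \<open>w = y\<close> or
  \<open>w = z\<close>. Squared, this is the equation of an ellipse that touches the unit circle at \<open>w\<close>.
\<close>

section \<open>The distance in the projective model\<close>

lemma mem_disc_iff: "x \<in> disc \<longleftrightarrow> x \<bullet> x < 1"
  by (simp add: norm_lt_square)

lemma mem_frontier_disc_iff: "x \<in> frontier disc \<longleftrightarrow> x \<bullet> x = 1"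
  by (simp add: norm_eq_1)

lemma inner_less_one_disc:
  assumes "x \<in> disc" "q \<bullet> q \<le> 1"
  shows "x \<bullet> q < 1"
proof -
  have "0 \<le> (x - q) \<bullet> (x - q)"
    by simp
  also have "\<dots> = x \<bullet> x - 2 * (x \<bullet> q) + q \<bullet> q"
    by (simp add: inner_diff inner_commute)
  finally show ?thesis
    using assms(2) assms(1)[unfolded mem_disc_iff] by linarith
qed

lemma inner_ray:
  fixes x w :: "'a::real_inner"
  shows "(x + r *\<^sub>R w) \<bullet> (x + r *\<^sub>R w) = x \<bullet> x + 2 * r * (x \<bullet> w) + r\<^sup>2 * (w \<bullet> w)"
  by (simp add: inner_add inner_commute power2_eq_square algebra_simps)

text \<open>Eliminating the linear term from the two circle equations leaves \<open>r - s\<close>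
  times a factor that is positive because the ray starts inside the circle. This is what makes
  \<open>hit_point\<close> well defined.\<close>

lemma ray_unit_circle_unique:
  fixes x w :: "'a::real_inner"
  assumes x: "x \<bullet> x < 1" and "0 \<le> r" "0 \<le> s"
    and r: "(x + r *\<^sub>R w) \<bullet> (x + r *\<^sub>R w) = 1" and s: "(x + s *\<^sub>R w) \<bullet> (x + s *\<^sub>R w) = 1"
  shows "r = s"
proof -
  have "(r - s) * (r * s * (w \<bullet> w) + (1 - x \<bullet> x)) = 0"
    using r s unfolding inner_ray by algebra
  moreover have "r * s * (w \<bullet> w) + (1 - x \<bullet> x) > 0"
    using assms by (intro add_nonneg_pos) auto
  ultimately show ?thesis by simp
qed

lemma hit_point_eqI:
  assumes "x \<in> disc" "0 \<le> r" "x + r *\<^sub>R (q - x) \<in> frontier disc"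
  shows "hit_point x q = x + r *\<^sub>R (q - x)"
  unfolding hit_point_def
proof (rule the_equality)
  show "x + r *\<^sub>R (q - x) \<in> frontier disc \<and> (\<exists>s\<ge>0. x + r *\<^sub>R (q - x) = x + s *\<^sub>R (q - x))"
    using assms by blast
next
  fix b
  assume "b \<in> frontier disc \<and> (\<exists>s\<ge>0. b = x + s *\<^sub>R (q - x))"
  then obtain s where "s \<ge> 0" "b = x + s *\<^sub>R (q - x)" "b \<in> frontier disc"
    by blast
  then show "b = x + r *\<^sub>R (q - x)"
    using assms ray_unit_circle_unique[of x r s "q - x"]
    by (simp only: mem_disc_iff mem_frontier_disc_iff)
qed

text \<open>A parameter \<open>r \<le> 1\<close> would give a convex combination of \<open>x\<close>
  and \<open>q\<close>, hence an interior point. The strict bound keeps all factors of the cross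
  ratio positive.\<close>

lemma hit_point_disc:
  assumes x: "x \<in> disc" and q: "q \<in> disc" and "x \<noteq> q"
  obtains r where "r > 1" "hit_point x q = x + r *\<^sub>R (q - x)"
    "(x + r *\<^sub>R (q - x)) \<bullet> (x + r *\<^sub>R (q - x)) = 1"
proof -
  obtain r where r: "0 < r" "x + r *\<^sub>R (q - x) \<in> frontier disc"
    using ray_to_frontier[of disc x "q - x"] assms by auto
  then have one: "(x + r *\<^sub>R (q - x)) \<bullet> (x + r *\<^sub>R (q - x)) = 1"
    by (simp only: mem_frontier_disc_iff)
  have "r > 1"
  proof (rule ccontr)
    assume "\<not> r > 1"
    then have "(1 - r) *\<^sub>R x + r *\<^sub>R q \<in> disc"
      using r(1) x q by (intro convexD[OF convex_ball]) auto
    moreover have "(1 - r) *\<^sub>R x + r *\<^sub>R q = x + r *\<^sub>R (q - x)"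
      by (simp add: algebra_simps)
    ultimately show False
      using one by (simp only: mem_disc_iff less_irrefl)
  qed
  then show ?thesis
    using that hit_point_eqI[OF x _ r(2)] r(1) one by simp
qed

lemma hilbert_dist_refl: "hilbert_dist x x = 0"
  by (simp add: hilbert_dist_def)

text \<open>The halved logarithm is the logarithm of a square root, so \<open>cosh\<close> turns the
  cross ratio into symmetric functions of \<open>P\<close> and \<open>Q\<close>.\<close>

lemma cosh_half_ln:
  fixes P Q :: real
  assumes "P > 0" "Q > 0"
  shows "cosh (1/2 * ln (P / Q)) = (P + Q) / (2 * sqrt (P * Q))"
proof -
  have "1/2 * ln (P / Q) = ln (sqrt (P / Q))"
    using assms by (simp add: ln_sqrt)
  then have "cosh (1/2 * ln (P / Q)) = (sqrt (P / Q) + inverse (sqrt (P / Q))) / 2"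
    using assms by (simp add: cosh_ln_real)
  also have "\<dots> = (sqrt P * sqrt P + sqrt Q * sqrt Q) / (2 * (sqrt P * sqrt Q))"
    using assms by (simp add: real_sqrt_divide field_simps del: real_sqrt_mult_self)
  finally show ?thesis
    using assms by (simp add: real_sqrt_mult)
qed

text \<open>\<open>P\<close> and \<open>Q\<close> are the numerator and the denominator of the cross
  ratio, written with the ray parameters of the two hitting points. Their sum and product are what
  \<open>cosh\<close> of the distance requires.\<close>

lemma hilbert_dist_cross_ratio:
  assumes x: "x \<in> disc" and q: "q \<in> disc" and neq: "x \<noteq> q"
  obtains P Q where "0 < Q" "Q < P" "hilbert_dist x q = 1/2 * ln (P / Q)"
    "1 - x \<bullet> q = (P + Q) / 2" "(1 - x \<bullet> x) * (1 - q \<bullet> q) = P * Q"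
proof -
  obtain r where r: "r > 1" "hit_point x q = x + r *\<^sub>R (q - x)"
    "(x + r *\<^sub>R (q - x)) \<bullet> (x + r *\<^sub>R (q - x)) = 1"
    using hit_point_disc[OF x q neq] .
  obtain s where s: "s > 1" "hit_point q x = q + s *\<^sub>R (x - q)"
    "(q + s *\<^sub>R (x - q)) \<bullet> (q + s *\<^sub>R (x - q)) = 1"
    using hit_point_disc[OF q x] neq by metis
  define W where "W = (q - x) \<bullet> (q - x)"
  have W: "W > 0" "W = x \<bullet> x + q \<bullet> q - 2 * (x \<bullet> q)"
    using neq by (simp add: W_def) (simp add: W_def inner_diff inner_commute)
  define P where "P = W * r * s"
  define Q where "Q = W * (r - 1) * (s - 1)"
  have norms: "norm (q - hit_point q x) = s * norm (q - x)"
    "norm (x - hit_point x q) = r * norm (q - x)"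
    "norm (x - hit_point q x) = (s - 1) * norm (q - x)"
    "norm (q - hit_point x q) = (r - 1) * norm (q - x)"
  proof -
    have "q - hit_point q x = s *\<^sub>R (q - x)" "x - hit_point x q = - (r *\<^sub>R (q - x))"
      "x - hit_point q x = (s - 1) *\<^sub>R (q - x)" "q - hit_point x q = - ((r - 1) *\<^sub>R (q - x))"
      unfolding r s by (simp_all add: algebra_simps)
    then show "norm (q - hit_point q x) = s * norm (q - x)"
      "norm (x - hit_point x q) = r * norm (q - x)"
      "norm (x - hit_point q x) = (s - 1) * norm (q - x)"
      "norm (q - hit_point x q) = (r - 1) * norm (q - x)"
      using r(1) s(1) by (simp_all only: norm_minus_cancel norm_scaleR abs_of_pos diff_gt_0_iff_gt less_trans[OF zero_less_one])
  qed
  have sq: "(norm (q - x))\<^sup>2 = W"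
    by (simp add: W_def power2_norm_eq_inner)
  have "hilbert_dist x q = 1/2 * ln ((s * norm (q - x) * (r * norm (q - x)))
      / ((s - 1) * norm (q - x) * ((r - 1) * norm (q - x))))"
    using neq by (simp add: hilbert_dist_def Let_def norms)
  also have "s * norm (q - x) * (r * norm (q - x)) = P"
    unfolding P_def sq[symmetric] by (simp add: power2_eq_square)
  also have "(s - 1) * norm (q - x) * ((r - 1) * norm (q - x)) = Q"
    unfolding Q_def sq[symmetric] by (simp add: power2_eq_square)
  finally have dist: "hilbert_dist x q = 1/2 * ln (P / Q)" .
  have qr: "x \<bullet> x + 2 * r * (x \<bullet> q - x \<bullet> x) + r\<^sup>2 * W = 1"
    using r(3) unfolding inner_ray W_def[symmetric] by (simp add: inner_diff)
  have qs: "q \<bullet> q + 2 * s * (x \<bullet> q - q \<bullet> q) + s\<^sup>2 * W = 1"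
  proof -
    have "(x - q) \<bullet> (x - q) = W"
      by (simp add: W_def inner_diff inner_commute)
    then show ?thesis
      using s(3) unfolding inner_ray by (simp add: inner_diff inner_commute)
  qed
  \<comment> \<open>\<open>r\<close> and \<open>1 - s\<close> are the two roots of \<open>1 - \<bar>x + \<rho> (q - x)\<bar>\<^sup>2\<close>, a quadratic polynomial in \<open>\<rho>\<close>
    with leading coefficient \<open>-W\<close>; the values at 0 and 1 follow from Vieta's formulas.\<close>
  have qs': "x \<bullet> x + 2 * (1 - s) * (x \<bullet> q - x \<bullet> x) + (1 - s)\<^sup>2 * W = 1"
    using qs W(2) by algebra
  \<comment> \<open>Difference of the two root equations. The factor \<open>r + s - 1\<close> is the
    gap between the roots \<open>r\<close> and \<open>1 - s\<close>, positive since
    \<open>r, s > 1\<close>.\<close>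
  have "(r + s - 1) * (2 * (x \<bullet> q - x \<bullet> x) + (r + 1 - s) * W) = 0"
    using qr qs' by algebra
  then have vieta: "2 * (x \<bullet> q - x \<bullet> x) + (r + 1 - s) * W = 0"
    using r(1) s(1) by simp
  have xx: "1 - x \<bullet> x = W * r * (s - 1)"
    using vieta qr by algebra
  have qq: "1 - q \<bullet> q = W * (r - 1) * s"
    using vieta xx W(2) by algebra
  have "2 * (1 - x \<bullet> q) = P + Q"
    using vieta xx unfolding P_def Q_def by algebra
  moreover have "(1 - x \<bullet> x) * (1 - q \<bullet> q) = P * Q"
    unfolding xx qq P_def Q_def by algebra
  moreover have "0 < Q"
    using W r(1) s(1) by (simp add: Q_def)
  moreover have "Q < P"
  proof -
    have "P - Q = W * (r + s - 1)"
      by (simp add: P_def Q_def algebra_simps)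
    then show ?thesis
      using W(1) r(1) s(1) by (smt (verit) mult_pos_pos)
  qed
  ultimately show ?thesis
    using that dist by simp
qed

text \<open>Needed because \<open>cosh\<close> determines a real number only up to sign.\<close>

lemma hilbert_dist_nonneg:
  assumes "x \<in> disc" "q \<in> disc"
  shows "0 \<le> hilbert_dist x q"
proof (cases "x = q")
  case False
  then obtain P Q where PQ: "0 < Q" "Q < P" "hilbert_dist x q = 1/2 * ln (P / Q)"
    using hilbert_dist_cross_ratio[OF assms] by metis
  then have "0 \<le> ln (P / Q)"
    by (intro ln_ge_zero) simp
  then show ?thesis
    by (simp add: PQ(3))
qed (simp add: hilbert_dist_refl)

lemma cosh_hilbert_dist:
  assumes "x \<in> disc" "q \<in> disc"
  shows "cosh (hilbert_dist x q) = (1 - x \<bullet> q) / (sqrt (1 - x \<bullet> x) * sqrt (1 - q \<bullet> q))"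
proof (cases "x = q")
  case True
  moreover have "q \<bullet> q < 1"
    using assms(2) by (simp only: mem_disc_iff)
  ultimately show ?thesis
    by (simp add: hilbert_dist_refl)
next
  case False
  then obtain P Q where PQ: "0 < Q" "Q < P" "hilbert_dist x q = 1/2 * ln (P / Q)"
    and e: "1 - x \<bullet> q = (P + Q) / 2" "(1 - x \<bullet> x) * (1 - q \<bullet> q) = P * Q"
    using hilbert_dist_cross_ratio[OF assms] by metis
  have "cosh (hilbert_dist x q) = (P + Q) / (2 * sqrt (P * Q))"
    unfolding PQ(3) using PQ by (intro cosh_half_ln) auto
  then show ?thesis
    by (simp add: e(1) flip: e(2) real_sqrt_mult)
qed

text \<open>The \<open>cosh\<close> formula is symmetric, and \<open>cosh\<close> is injective on
  nonnegative reals. Forward spheres can thus be treated with the same formula as the Busemann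
  function.\<close>

lemma hilbert_dist_commute:
  assumes "x \<in> disc" "q \<in> disc"
  shows "hilbert_dist x q = hilbert_dist q x"
proof -
  have "cosh (hilbert_dist x q) = cosh (hilbert_dist q x)"
    using assms by (simp add: cosh_hilbert_dist inner_commute)
  then show ?thesis
    using assms by (simp add: hilbert_dist_nonneg)
qed

section \<open>Geodesics\<close>

text \<open>Here \<open>z\<close> is the backward endpoint. The geodesic point is the mean of
  \<open>y\<close> and \<open>z\<close> with weights \<open>exp t\<close> and
  \<open>k * exp (- t)\<close>, so \<open>1 - x \<bullet> g\<close> splits into the two exponential
  terms.\<close>

lemma geodesic_identities:
  fixes p y x :: "real^2" and t :: real
  assumes p: "p \<in> disc" and y: "y \<in> frontier disc"
  defines "k \<equiv> (norm (y - p))\<^sup>2 / ((norm y)\<^sup>2 - (norm p)\<^sup>2)"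
  defines "z \<equiv> p - (1 / k) *\<^sub>R (y - p)"
    and "m \<equiv> (k + 1) * sqrt (1 - p \<bullet> p)"
  shows "k > 0" "m > 0" "z \<bullet> z = 1" "geodesic p y t \<in> disc"
    "x \<in> disc \<Longrightarrow> cosh (hilbert_dist x (geodesic p y t)) =
      (exp t * (1 - x \<bullet> y) + exp (- t) * (k * (1 - x \<bullet> z))) / (m * sqrt (1 - x \<bullet> x))"
proof -
  have pp: "p \<bullet> p < 1" and yy: "y \<bullet> y = 1"
    using p y by (simp_all only: mem_disc_iff mem_frontier_disc_iff)
  then have "y \<noteq> p" by auto
  have k_eq: "k = ((y - p) \<bullet> (y - p)) / (1 - p \<bullet> p)"
    by (simp add: k_def power2_norm_eq_inner yy)
  show k: "k > 0"
    unfolding k_eq using \<open>y \<noteq> p\<close> pp by simp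
  then show m: "m > 0"
    using pp by (simp add: m_def)
  \<comment> \<open>The definition of \<open>k\<close> with its denominator cleared; both norm
    computations below reduce to it.\<close>
  have kp: "k * (1 - p \<bullet> p) = 1 + p \<bullet> p - 2 * (p \<bullet> y)"
    using pp by (simp add: k_eq inner_diff inner_commute yy)
  have kz: "k *\<^sub>R z = (k + 1) *\<^sub>R p - y"
    using k by (simp add: z_def algebra_simps)
  have "k\<^sup>2 * (z \<bullet> z) = (k *\<^sub>R z) \<bullet> (k *\<^sub>R z)"
    by (simp add: power2_eq_square)
  also have "\<dots> = (k + 1)\<^sup>2 * (p \<bullet> p) - 2 * (k + 1) * (p \<bullet> y) + 1"
    unfolding kz by (simp add: inner_diff inner_commute yy power2_eq_square algebra_simps)
  also have "\<dots> = k\<^sup>2"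
    using kp by algebra
  finally show "z \<bullet> z = 1"
    using k by simp
  define e f where "e = exp t" and "f = exp (- t)"
  have ef: "e > 0" "f > 0" "e * f = 1"
    by (simp_all add: e_def f_def exp_minus)
  \<comment> \<open>The denominator of \<open>geodesic_param\<close>; scaling by it keeps the
    computations polynomial.\<close>
  define N where "N = e + k * f"
  have N: "N > 0"
    using ef k by (simp add: N_def add_pos_pos)
  define g where "g = geodesic p y t"
  have s: "geodesic_param p y t = (e - f) / N"
    by (simp add: geodesic_param_def Let_def k_def e_def f_def N_def)
  have "1 - (e - f) / N = ((k + 1) * f) / N"
    using N by (simp add: N_def field_simps)
  then have Ng: "N *\<^sub>R g = ((k + 1) * f) *\<^sub>R p + (e - f) *\<^sub>R y"
    using N by (simp add: g_def geodesic_def s scaleR_add_right)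
  have "N\<^sup>2 * (g \<bullet> g) = (N *\<^sub>R g) \<bullet> (N *\<^sub>R g)"
    by (simp add: power2_eq_square)
  also have "\<dots> = ((k + 1) * f)\<^sup>2 * (p \<bullet> p) + 2 * ((k + 1) * f) * (e - f) * (p \<bullet> y) + (e - f)\<^sup>2"
    unfolding Ng by (simp add: inner_add inner_commute yy power2_eq_square algebra_simps)
  finally have "N\<^sup>2 * (1 - g \<bullet> g) = N\<^sup>2 -
      (((k + 1) * f)\<^sup>2 * (p \<bullet> p) + 2 * ((k + 1) * f) * (e - f) * (p \<bullet> y) + (e - f)\<^sup>2)"
    by (simp add: algebra_simps)
  \<comment> \<open>The dependence on \<open>t\<close> cancels through
    \<open>e * f = 1\<close>.\<close>
  also have "\<dots> = (k + 1)\<^sup>2 * (1 - p \<bullet> p)"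
    using ef(3) kp unfolding N_def by algebra
  finally have gg: "N\<^sup>2 * (1 - g \<bullet> g) = m\<^sup>2"
    using pp by (simp add: m_def power_mult_distrib)
  then have "1 - g \<bullet> g > 0"
    using m N by (metis zero_less_mult_pos zero_less_power)
  then show g: "geodesic p y t \<in> disc"
    by (simp only: mem_disc_iff g_def[symmetric] diff_gt_0_iff_gt)
  have "1 - g \<bullet> g = (m / N)\<^sup>2"
    using gg N by (simp add: power_divide field_simps)
  then have root: "sqrt (1 - g \<bullet> g) = m / N"
    using m N by simp
  assume x: "x \<in> disc"
  have "N * (1 - x \<bullet> g) = N - x \<bullet> (N *\<^sub>R g)"
    by (simp add: algebra_simps)
  also have "\<dots> = e * (1 - x \<bullet> y) + f * (k - x \<bullet> (k *\<^sub>R z))"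
    unfolding Ng kz by (simp add: N_def inner_add_right inner_diff_right algebra_simps)
  finally have num: "N * (1 - x \<bullet> g) = e * (1 - x \<bullet> y) + f * (k * (1 - x \<bullet> z))"
    by (simp add: algebra_simps)
  have "cosh (hilbert_dist x g) = (N * (1 - x \<bullet> g)) / (m * sqrt (1 - x \<bullet> x))"
    using cosh_hilbert_dist[OF x g] N by (simp add: root g_def[symmetric] mult.commute)
  then show "cosh (hilbert_dist x (geodesic p y t)) =
      (exp t * (1 - x \<bullet> y) + exp (- t) * (k * (1 - x \<bullet> z))) / (m * sqrt (1 - x \<bullet> x))"
    unfolding num by (simp add: e_def f_def g_def)
qed

text \<open>Up to vanishing terms, \<open>cosh (d t)\<close> is \<open>exp (d t) / 2\<close> on one
  side and \<open>exp t * A\<close> on the other, so \<open>exp (d t - t)\<close> tends to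
  \<open>2 * A\<close>.\<close>

lemma tendsto_minus_of_cosh_eq:
  fixes d :: "real \<Rightarrow> real"
  assumes A: "A > 0" and d: "\<And>t. 0 \<le> d t" "\<And>t. cosh (d t) = exp t * A + exp (- t) * B"
  shows "((\<lambda>t. t - d t) \<longlongrightarrow> - ln (2 * A)) at_top"
proof -
  have eq: "exp (d t - t) = 2 * A + 2 * B * exp (- (2 * t)) - exp (- d t) * exp (- t)" for t
  proof -
    have "exp (d t) = 2 * A * exp t + 2 * B * exp (- t) - exp (- d t)"
      using d(2)[of t] by (simp add: cosh_def field_simps)
    then have "exp (d t) * exp (- t) =
        2 * A * (exp t * exp (- t)) + 2 * B * (exp (- t) * exp (- t)) - exp (- d t) * exp (- t)"
      by (simp only: left_diff_distrib distrib_right mult.assoc)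
    then show ?thesis
      by (simp flip: exp_add)
  qed
  have lim0: "((\<lambda>t::real. exp (- t)) \<longlongrightarrow> 0) at_top" "((\<lambda>t::real. exp (- (2 * t))) \<longlongrightarrow> 0) at_top"
    by real_asymp+
  \<comment> \<open>Nonnegativity of \<open>d\<close> bounds \<open>exp (- d t)\<close> by
    1.\<close>
  have "((\<lambda>t. exp (- d t) * exp (- t)) \<longlongrightarrow> 0) at_top"
    by (rule Lim_null_comparison[OF _ lim0(1)]) (use d(1) in \<open>auto intro!: always_eventually\<close>)
  then have "((\<lambda>t. exp (d t - t)) \<longlongrightarrow> 2 * A + 2 * B * 0 - 0) at_top"
    unfolding eq by (intro tendsto_intros lim0)
  then have "((\<lambda>t. ln (exp (d t - t))) \<longlongrightarrow> ln (2 * A)) at_top"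
    using A by (intro tendsto_ln) auto
  then show ?thesis
    using tendsto_minus by fastforce
qed

section \<open>Limits of level sets\<close>

text \<open>A point in only one of the limits would have a neighbourhood that late sets both meet
  and avoid. This justifies the definite description in \<open>backward_horocycle\<close>.\<close>

lemma set_limit_in_unique:
  assumes "set_limit_in U S H" "set_limit_in U S H'"
  shows "H = H'"
proof -
  have "H \<subseteq> H'" if lim: "set_limit_in U S H" "set_limit_in U S H'" for H H'
  proof
    fix x assume x: "x \<in> H"
    show "x \<in> H'"
    proof (rule ccontr)
      assume "x \<notin> H'"
      then have "x \<in> U - H'"
        using lim(1) x by (auto simp: set_limit_in_def)
      then obtain e where e: "e > 0" "\<forall>\<^sub>F t in at_top. S t \<inter> ball x e = {}"
        using lim(2) unfolding set_limit_in_def by meson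
      have "\<forall>\<^sub>F t in at_top. S t \<inter> ball x e \<noteq> {}"
        using lim(1) x e(1) by (simp add: set_limit_in_def)
      with e(2) have "\<forall>\<^sub>F t::real in at_top. False"
        by eventually_elim simp
      then show False by simp
    qed
  qed
  then show ?thesis
    using assms by blast
qed

text \<open>Near a zero of \<open>g\<close>, a sign change survives small perturbations and the
  intermediate value theorem gives a nearby zero; a zero without sign change could disappear. Away
  from the zeros, \<open>g\<close> is locally bounded away from 0 and \<open>h\<close> is locally
  bounded, so late perturbations cannot cancel \<open>g\<close>.\<close>

lemma set_limit_in_level_set:
  fixes g h :: "'a::real_normed_vector \<Rightarrow> real" and \<delta> :: "real \<Rightarrow> real"
  assumes U: "open U" "convex U" and cont: "continuous_on U g" "continuous_on U h"
    and \<delta>: "(\<delta> \<longlongrightarrow> 0) at_top"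
    and S: "\<forall>\<^sub>F t in at_top. S t = {x \<in> U. g x + \<delta> t * h x = 0}"
    and change: "\<And>x e. x \<in> U \<Longrightarrow> g x = 0 \<Longrightarrow> e > 0 \<Longrightarrow>
      \<exists>u \<in> U \<inter> ball x e. \<exists>v \<in> U \<inter> ball x e. g u < 0 \<and> 0 < g v"
  shows "set_limit_in U S {x \<in> U. g x = 0}"
  unfolding set_limit_in_def
proof (intro conjI ballI allI impI)
  show "{x \<in> U. g x = 0} \<subseteq> U" by blast
next
  fix x and e :: real
  assume x: "x \<in> {x \<in> U. g x = 0}" and "e > 0"
  then obtain u v where uv: "u \<in> U \<inter> ball x e" "v \<in> U \<inter> ball x e" "g u < 0" "0 < g v"
    using change by blast
  \<comment> \<open>Only the two fixed points \<open>u\<close> and \<open>v\<close> matter here, so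
    pointwise convergence suffices.\<close>
  have lim: "((\<lambda>t. g w + \<delta> t * h w) \<longlongrightarrow> g w + 0 * h w) at_top" for w
    by (intro tendsto_intros \<delta>)
  have "\<forall>\<^sub>F t in at_top. g u + \<delta> t * h u < 0" "\<forall>\<^sub>F t in at_top. 0 < g v + \<delta> t * h v"
    using order_tendstoD[OF lim] uv by auto
  with S show "\<forall>\<^sub>F t in at_top. S t \<inter> ball x e \<noteq> {}"
  proof eventually_elim
    case (elim t)
    let ?f = "\<lambda>x. g x + \<delta> t * h x"
    \<comment> \<open>The intersection of \<open>U\<close> with a ball is convex, so its image is an
      interval containing values of both signs.\<close>
    have "connected (?f ` (U \<inter> ball x e))"
      using U(2) cont
      by (intro connected_continuous_image continuous_intros convex_connected convex_Int convex_ball)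
        (auto intro: continuous_on_subset)
    then have "0 \<in> ?f ` (U \<inter> ball x e)"
    proof (rule connectedD_interval[of _ "?f u" "?f v"])
      show "?f u \<in> ?f ` (U \<inter> ball x e)"
        using uv(1) by (rule imageI)
      show "?f v \<in> ?f ` (U \<inter> ball x e)"
        using uv(2) by (rule imageI)
    qed (use elim in auto)
    then show ?case
      using elim(1) by auto
  qed
next
  fix x
  assume x: "x \<in> U - {x \<in> U. g x = 0}"
  then have cx: "g \<midarrow>x\<rightarrow> g x" "h \<midarrow>x\<rightarrow> h x"
    using cont U(1) by (auto simp: continuous_on_eq_continuous_at isCont_def)
  have gx: "\<bar>g x\<bar> > 0"
    using x by auto
  have "\<forall>\<^sub>F w in at x. \<bar>g w\<bar> > \<bar>g x\<bar> / 2" "\<forall>\<^sub>F w in at x. \<bar>h w\<bar> < \<bar>h x\<bar> + 1"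
    using order_tendstoD(1)[OF tendsto_rabs[OF cx(1)], of "\<bar>g x\<bar> / 2"]
      order_tendstoD(2)[OF tendsto_rabs[OF cx(2)], of "\<bar>h x\<bar> + 1"] gx by auto
  then have "\<forall>\<^sub>F w in at x. \<bar>g w\<bar> > \<bar>g x\<bar> / 2 \<and> \<bar>h w\<bar> < \<bar>h x\<bar> + 1"
    by (rule eventually_conj)
  then obtain e where e: "e > 0"
    "\<And>w. w \<noteq> x \<Longrightarrow> dist w x < e \<Longrightarrow> \<bar>g w\<bar> > \<bar>g x\<bar> / 2 \<and> \<bar>h w\<bar> < \<bar>h x\<bar> + 1"
    unfolding eventually_at by blast
  have near: "\<bar>g w\<bar> > \<bar>g x\<bar> / 2 \<and> \<bar>h w\<bar> < \<bar>h x\<bar> + 1" if "w \<in> ball x e" for w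
    using e(2)[of w] that gx by (cases "w = x") (auto simp: dist_commute)
  have "((\<lambda>t. \<bar>\<delta> t\<bar> * (\<bar>h x\<bar> + 1)) \<longlongrightarrow> \<bar>0\<bar> * (\<bar>h x\<bar> + 1)) at_top"
    by (intro tendsto_intros \<delta>)
  then have "\<forall>\<^sub>F t in at_top. \<bar>\<delta> t\<bar> * (\<bar>h x\<bar> + 1) < \<bar>g x\<bar> / 2"
    by (rule order_tendstoD(2)) (use gx in simp)
  with S have "\<forall>\<^sub>F t in at_top. S t \<inter> ball x e = {}"
  proof eventually_elim
    case (elim t)
    have "g w + \<delta> t * h w \<noteq> 0" if "w \<in> ball x e" for w
    proof
      assume "g w + \<delta> t * h w = 0"
      then have "\<bar>g w\<bar> = \<bar>\<delta> t\<bar> * \<bar>h w\<bar>"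
        by (metis abs_minus_cancel abs_mult add_eq_0_iff)
      also have "\<dots> \<le> \<bar>\<delta> t\<bar> * (\<bar>h x\<bar> + 1)"
        using near[OF that] by (intro mult_left_mono) auto
      finally show False
        using near[OF that] elim(2) by linarith
    qed
    then show ?case
      using elim(1) by auto
  qed
  with e(1) show "\<exists>e>0. \<forall>\<^sub>F t in at_top. S t \<inter> ball x e = {}"
    by blast
qed

section \<open>Horocycles\<close>

text \<open>Squaring gives a quadric; completing the square along \<open>w\<close> gives centre
  \<open>w / (1 + c\<^sup>2)\<close> and semi-axes \<open>c\<^sup>2 / (1 + c\<^sup>2)\<close> and
  \<open>c / sqrt (1 + c\<^sup>2)\<close>. The only point gained by squaring is
  \<open>w\<close>.\<close>

lemma horocycle_equation_ellipse:
  fixes w :: "real^2" and c :: real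
  assumes w: "w \<bullet> w = 1" and c: "c > 0"
  shows "\<exists>E. is_ellipse E \<and> w \<in> E \<and> {x \<in> disc. 1 - x \<bullet> w = c * sqrt (1 - x \<bullet> x)} = E - {w}"
proof -
  define E where "E = {x::real^2. (1 - x \<bullet> w)\<^sup>2 = c\<^sup>2 * (1 - x \<bullet> x)}"
  \<comment> \<open>A quarter turn of \<open>w\<close>, completing it to an orthonormal
    basis.\<close>
  define v :: "real^2" where "v = vector [- w $ 2, w $ 1]"
  have w2: "w $ 1 * w $ 1 + w $ 2 * w $ 2 = 1"
    using w by (simp add: inner_vec_def sum_2)
  have v: "v \<bullet> v = 1" "w \<bullet> v = 0"
    using w2 by (simp_all add: v_def inner_vec_def sum_2)
  have pythagoras: "x \<bullet> x = (x \<bullet> w)\<^sup>2 + (x \<bullet> v)\<^sup>2" for x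
  proof -
    have "(x \<bullet> w)\<^sup>2 + (x \<bullet> v)\<^sup>2 =
        (x $ 1 * x $ 1 + x $ 2 * x $ 2) * (w $ 1 * w $ 1 + w $ 2 * w $ 2)"
      by (simp add: v_def inner_vec_def sum_2 power2_eq_square algebra_simps)
    then show ?thesis
      unfolding w2 by (simp add: inner_vec_def sum_2)
  qed
  define D where "D = 1 + c\<^sup>2"
  have D: "D > 0"
    by (simp add: D_def add_pos_nonneg)
  have "E = {x. ((x - (1 / D) *\<^sub>R w) \<bullet> w)\<^sup>2 / (c\<^sup>2 / D)\<^sup>2
      + ((x - (1 / D) *\<^sub>R w) \<bullet> v)\<^sup>2 / (c / sqrt D)\<^sup>2 = 1}"
  proof -
    have quadric: "(1 - X)\<^sup>2 = c\<^sup>2 * (1 - (X\<^sup>2 + Y\<^sup>2)) \<longleftrightarrow>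
        (X - 1 / D)\<^sup>2 / (c\<^sup>2 / D)\<^sup>2 + Y\<^sup>2 / (c / sqrt D)\<^sup>2 = 1" for X Y
    proof -
      have "(X - 1 / D)\<^sup>2 / (c\<^sup>2 / D)\<^sup>2 + Y\<^sup>2 / (c / sqrt D)\<^sup>2 = 1 \<longleftrightarrow>
          (D * X - 1)\<^sup>2 + c\<^sup>2 * D * Y\<^sup>2 = c\<^sup>2 * c\<^sup>2"
      proof -
        have "(X - 1 / D) / (c\<^sup>2 / D) = (D * X - 1) / c\<^sup>2"
          using c D by (simp add: field_simps)
        then have "(X - 1 / D)\<^sup>2 / (c\<^sup>2 / D)\<^sup>2 = (D * X - 1)\<^sup>2 / (c\<^sup>2 * c\<^sup>2)"
          unfolding power_divide[symmetric]
          by (simp only: power_divide power2_eq_square[of "c\<^sup>2"])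
        moreover have "Y\<^sup>2 / (c / sqrt D)\<^sup>2 = c\<^sup>2 * D * Y\<^sup>2 / (c\<^sup>2 * c\<^sup>2)"
          using c D by (simp add: power_divide field_simps)
        ultimately show ?thesis
          using c by (simp add: add_divide_distrib[symmetric]) (rule eq_commute)
      qed
      also have "\<dots> \<longleftrightarrow> D * ((1 - X)\<^sup>2 - c\<^sup>2 * (1 - (X\<^sup>2 + Y\<^sup>2))) = 0"
      proof -
        have "(D * X - 1)\<^sup>2 + c\<^sup>2 * D * Y\<^sup>2 - c\<^sup>2 * c\<^sup>2 = D * ((1 - X)\<^sup>2 - c\<^sup>2 * (1 - (X\<^sup>2 + Y\<^sup>2)))"
          unfolding D_def by algebra
        then show ?thesis by (metis right_minus_eq)
      qed
      finally show ?thesis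
        using D by simp
    qed
    have "(x - (1 / D) *\<^sub>R w) \<bullet> w = x \<bullet> w - 1 / D" "(x - (1 / D) *\<^sub>R w) \<bullet> v = x \<bullet> v" for x
      using w v by (simp_all add: inner_diff_left)
    then show ?thesis
      unfolding E_def by (simp only: pythagoras quadric)
  qed
  moreover have "c\<^sup>2 / D > 0" "c / sqrt D > 0"
    using c D by auto
  moreover have "norm w = 1" "norm v = 1"
    using w v by (simp_all add: norm_eq_1)
  ultimately have "is_ellipse E"
    unfolding is_ellipse_def using v(2)
    by (intro exI[of _ "(1 / D) *\<^sub>R w"] exI[of _ w] exI[of _ v] exI[of _ "c\<^sup>2 / D"]
        exI[of _ "c / sqrt D"] conjI)
  moreover have "w \<in> E"
    using w by (simp add: E_def)
  moreover have "{x \<in> disc. 1 - x \<bullet> w = c * sqrt (1 - x \<bullet> x)} = E - {w}"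
  proof (intro set_eqI iffI)
    fix x
    assume "x \<in> {x \<in> disc. 1 - x \<bullet> w = c * sqrt (1 - x \<bullet> x)}"
    then have "x \<bullet> x < 1" "1 - x \<bullet> w = c * sqrt (1 - x \<bullet> x)"
      by (simp_all only: mem_Collect_eq mem_disc_iff)
    then show "x \<in> E - {w}"
      using w by (cases "x = w") (simp_all add: E_def power_mult_distrib)
  next
    fix x
    assume "x \<in> E - {w}"
    then have x: "(1 - x \<bullet> w)\<^sup>2 = c\<^sup>2 * (1 - x \<bullet> x)" "x \<noteq> w"
      by (auto simp: E_def)
    \<comment> \<open>The quadric lies in the closed disc; together with \<open>x \<noteq> w\<close>
      this identity makes \<open>1 - x \<bullet> w\<close> positive. The equation then forces
      \<open>x\<close> into the open disc, and the square root can be taken.\<close>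
    have diff: "(x - w) \<bullet> (x - w) = x \<bullet> x - 2 * (x \<bullet> w) + 1"
      by (simp add: inner_diff inner_commute w)
    have pos: "(x - w) \<bullet> (x - w) > 0"
      using x(2) by simp
    have "0 \<le> c\<^sup>2 * (1 - x \<bullet> x)"
      by (simp flip: x(1))
    then have "x \<bullet> x \<le> 1"
      using c by (simp add: zero_le_mult_iff)
    then have le: "0 < 1 - x \<bullet> w"
      using pos diff by linarith
    then have "0 < c\<^sup>2 * (1 - x \<bullet> x)"
      by (simp flip: x(1))
    then have lt: "x \<bullet> x < 1"
      using c by (simp add: zero_less_mult_iff)
    have "1 - x \<bullet> w = sqrt ((1 - x \<bullet> w)\<^sup>2)"
      using le by simp
    also have "\<dots> = c * sqrt (1 - x \<bullet> x)"
      unfolding x(1) using c by (simp add: real_sqrt_mult)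
    finally show "x \<in> {x \<in> disc. 1 - x \<bullet> w = c * sqrt (1 - x \<bullet> x)}"
      using lt by (simp only: mem_Collect_eq mem_disc_iff)
  qed
  ultimately show ?thesis
    by (intro exI[of _ E] conjI)
qed

text \<open>On the line from \<open>x\<close> to \<open>w\<close>, the difference of the squared
  sides is a quadratic with simple roots at \<open>x\<close> and \<open>w\<close>, so it changes
  sign when passing through \<open>x\<close>.\<close>

lemma horocycle_equation_sign_change:
  fixes x w :: "real^2"
  assumes w: "w \<bullet> w = 1" and c: "c > 0" and x: "x \<in> disc"
    and eq: "1 - x \<bullet> w = c * sqrt (1 - x \<bullet> x)" and e: "e > 0"
  shows "\<exists>u \<in> disc \<inter> ball x e. \<exists>v \<in> disc \<inter> ball x e.
    1 - u \<bullet> w < c * sqrt (1 - u \<bullet> u) \<and> c * sqrt (1 - v \<bullet> v) < 1 - v \<bullet> w"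
proof -
  define q where "q s = x + s *\<^sub>R (w - x)" for s :: real
  have xx: "x \<bullet> x < 1"
    using x by (simp only: mem_disc_iff)
  have eq2: "(1 - x \<bullet> w)\<^sup>2 = c\<^sup>2 * (1 - x \<bullet> x)"
    using xx unfolding eq by (simp add: power_mult_distrib)
  define K where "K = c\<^sup>2 * ((1 - x \<bullet> x) + (x - w) \<bullet> (x - w))"
  have K: "K > 0"
    using c xx unfolding K_def by (intro mult_pos_pos add_pos_nonneg) auto
  have id: "(1 - q s \<bullet> w)\<^sup>2 - c\<^sup>2 * (1 - q s \<bullet> q s) = - (s * (1 - s) * K)" for s
  proof -
    have 1: "q s \<bullet> w = x \<bullet> w + s * (1 - x \<bullet> w)"
      by (simp add: q_def inner_add_left inner_diff_left w)
    have 2: "q s \<bullet> q s = x \<bullet> x + 2 * s * (x \<bullet> w - x \<bullet> x) + s\<^sup>2 * (1 - 2 * (x \<bullet> w) + x \<bullet> x)"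
      unfolding q_def inner_ray by (simp add: inner_diff inner_commute w)
    have 3: "(x - w) \<bullet> (x - w) = 1 - 2 * (x \<bullet> w) + x \<bullet> x"
      by (simp add: inner_diff inner_commute w)
    show ?thesis
      unfolding 1 2 3 K_def using eq2 by algebra
  qed
  have "(q \<longlongrightarrow> x + 0 *\<^sub>R (w - x)) (at 0)"
    unfolding q_def by (intro tendsto_intros)
  moreover have "open (disc \<inter> ball x e)"
    by (intro open_Int open_ball)
  moreover have "x \<in> disc \<inter> ball x e"
    using x e by auto
  ultimately have "\<forall>\<^sub>F s in at 0. q s \<in> disc \<inter> ball x e"
    using topological_tendstoD[of q "x + 0 *\<^sub>R (w - x)"] by (simp del: Int_iff mem_ball)
  then obtain d where d: "d > 0" "\<And>s. s \<noteq> 0 \<Longrightarrow> dist s 0 < d \<Longrightarrow> q s \<in> disc \<inter> ball x e"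
    unfolding eventually_at by blast
  \<comment> \<open>Small enough that \<open>q s\<close> and \<open>q (- s)\<close> stay near
    \<open>x\<close>, and below the second root 1.\<close>
  define s where "s = min (d / 2) (1 / 2)"
  have s: "0 < s" "s < d" "s < 1"
    using d(1) by (auto simp: s_def)
  have root: "c * sqrt (1 - r \<bullet> r) = sqrt (c\<^sup>2 * (1 - r \<bullet> r))" for r :: "real^2"
    using c by (simp add: real_sqrt_mult)
  have mem: "q s \<in> disc \<inter> ball x e" "q (- s) \<in> disc \<inter> ball x e"
    using s by (intro d(2); simp)+
  have "(1 - q s \<bullet> w)\<^sup>2 < c\<^sup>2 * (1 - q s \<bullet> q s)"
    using id[of s] s K by (smt (verit) mult_pos_pos)
  then have "1 - q s \<bullet> w < c * sqrt (1 - q s \<bullet> q s)"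
    unfolding root by (rule real_less_rsqrt)
  moreover have "c\<^sup>2 * (1 - q (- s) \<bullet> q (- s)) < (1 - q (- s) \<bullet> w)\<^sup>2"
    using id[of "- s"] s K by (smt (verit) mult_pos_pos mult_minus_left)
  \<comment> \<open>Removing the squares in this direction uses
    \<open>1 - q (- s) \<bullet> w > 0\<close>, which holds inside the disc.\<close>
  then have "c * sqrt (1 - q (- s) \<bullet> q (- s)) < 1 - q (- s) \<bullet> w"
    unfolding root using inner_less_one_disc[of "q (- s)" w] mem w
    by (intro real_less_lsqrt) auto
  ultimately show ?thesis
    using mem by blast
qed

theorem proposition6p2:
  fixes p y :: "real^2" and a :: real
  assumes "p \<in> disc" and "y \<in> frontier disc"
  shows "(\<exists>E. is_ellipse E \<and> y \<in> E \<and> forward_horocycle (geodesic p y) a = E - {y}) \<and>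
         (\<exists>E. let z = hit_point p (p - (y - p))
              in is_ellipse E \<and> z \<in> E \<and> backward_horocycle (geodesic p y) a = E - {z})"
proof -
  define k where "k = (norm (y - p))\<^sup>2 / ((norm y)\<^sup>2 - (norm p)\<^sup>2)"
  define z where "z = p - (1 / k) *\<^sub>R (y - p)"
  define m where "m = (k + 1) * sqrt (1 - p \<bullet> p)"
  note ids = geodesic_identities[OF assms, folded k_def, folded z_def m_def]
  note k = ids(1) and m = ids(2) and zz = ids(3) and geo = ids(4)
  have yy: "y \<bullet> y = 1"
    using assms(2) by (simp only: mem_frontier_disc_iff)
  \<comment> \<open>The point \<open>p - (y - p)\<close> is the reflection of \<open>y\<close> in
    \<open>p\<close>; the backward ray reaches the circle at parameter \<open>1 / k\<close>.\<close>
  have z: "hit_point p (p - (y - p)) = z"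
  proof -
    have "z = p + (1 / k) *\<^sub>R (p - (y - p) - p)"
      by (simp add: z_def algebra_simps)
    then show ?thesis
      using hit_point_eqI[OF assms(1), of "1 / k" "p - (y - p)"] k zz
      by (simp only: mem_frontier_disc_iff) simp
  qed
  \<comment> \<open>The coefficients of \<open>exp t\<close> and \<open>exp (- t)\<close> in
    \<open>cosh\<close> of the distance. \<open>A\<close> governs the forward limit, and
    \<open>B\<close> the backward one, where \<open>t\<close> is replaced by
    \<open>- t\<close>.\<close>
  define A where "A x = (1 - x \<bullet> y) / (m * sqrt (1 - x \<bullet> x))" for x
  define B where "B x = k * (1 - x \<bullet> z) / (m * sqrt (1 - x \<bullet> x))" for x
  have cosh_eq: "cosh (hilbert_dist x (geodesic p y t)) = exp t * A x + exp (- t) * B x"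
    if "x \<in> disc" for x t
    unfolding A_def B_def ids(5)[OF that] by (simp add: add_divide_distrib)
  have root: "sqrt (1 - x \<bullet> x) > 0" if "x \<in> disc" for x
    using that by (simp only: mem_disc_iff) simp
  have A_pos: "A x > 0" if "x \<in> disc" for x
    using inner_less_one_disc[OF that, of y] root[OF that] yy m by (simp add: A_def)
  have busemann_eq: "busemann (geodesic p y) x = - ln (2 * A x)" if "x \<in> disc" for x
    unfolding busemann_def
    using tendsto_minus_of_cosh_eq[OF A_pos[OF that] hilbert_dist_nonneg[OF that geo] cosh_eq[OF that]]
    by (intro tendsto_Lim) auto
  have level: "- ln (2 * A x) = a \<longleftrightarrow> 1 - x \<bullet> y = (m * exp (- a) / 2) * sqrt (1 - x \<bullet> x)"
    if "x \<in> disc" for x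
  proof -
    have "- ln (2 * A x) = a \<longleftrightarrow> 2 * A x = exp (- a)"
      using A_pos[OF that] by (metis equation_minus_iff exp_ln ln_exp zero_less_mult_iff zero_less_numeral)
    then show ?thesis
      using root[OF that] m by (simp add: A_def field_simps)
  qed
  have "forward_horocycle (geodesic p y) a =
      {x \<in> disc. 1 - x \<bullet> y = (m * exp (- a) / 2) * sqrt (1 - x \<bullet> x)}"
    unfolding forward_horocycle_def
    by (rule Collect_cong) (use busemann_eq level in \<open>simp cong: conj_cong\<close>)
  then have forward: "\<exists>E. is_ellipse E \<and> y \<in> E \<and> forward_horocycle (geodesic p y) a = E - {y}"
    using horocycle_equation_ellipse[OF yy, of "m * exp (- a) / 2"] m by simp
  \<comment> \<open>Chosen so that \<open>B x = exp (- a) / 2\<close> becomes the common horocycle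
    equation with \<open>w = z\<close>.\<close>
  define c where "c = m * exp (- a) / (2 * k)"
  have c: "c > 0"
    using m k by (simp add: c_def)
  \<comment> \<open>The limiting equation: comparing the \<open>exp t\<close> terms of
    \<open>cosh\<close> of the distance to \<open>geodesic p y (- t)\<close> and of
    \<open>cosh (t - a)\<close>.\<close>
  define g where "g x = B x - exp (- a) / 2" for x
  have g_eq: "g x = k / (m * sqrt (1 - x \<bullet> x)) * ((1 - x \<bullet> z) - c * sqrt (1 - x \<bullet> x))"
    if "x \<in> disc" for x
    using root[OF that] m k by (simp add: g_def B_def c_def field_simps)
  have g_pos: "k / (m * sqrt (1 - x \<bullet> x)) > 0" if "x \<in> disc" for x
    using root[OF that] m k by simp
  have zero: "g x = 0 \<longleftrightarrow> 1 - x \<bullet> z = c * sqrt (1 - x \<bullet> x)" if "x \<in> disc" for x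
    unfolding g_eq[OF that] using g_pos[OF that] by (metis right_minus_eq less_irrefl mult_eq_0_iff)
  have lim: "set_limit_in disc (\<lambda>t. forward_sphere (geodesic p y (- t)) (t - a)) {x \<in> disc. g x = 0}"
  proof (rule set_limit_in_level_set)
    have nz: "m * sqrt (1 - x \<bullet> x) \<noteq> 0" if "x \<in> disc" for x
      using root[OF that] m by simp
    show "continuous_on disc g"
      unfolding g_def B_def using nz by (intro continuous_intros) blast
    show "continuous_on disc (\<lambda>x. A x - exp a / 2)"
      unfolding A_def using nz by (intro continuous_intros) blast
    show "((\<lambda>t::real. exp (- (2 * t))) \<longlongrightarrow> 0) at_top"
      by real_asymp
    show "\<forall>\<^sub>F t in at_top. forward_sphere (geodesic p y (- t)) (t - a) =
        {x \<in> disc. g x + exp (- (2 * t)) * (A x - exp a / 2) = 0}"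
      \<comment> \<open>For \<open>t \<ge> a\<close> the radius is nonnegative, so equality of
        distance and radius is equivalent to equality of their \<open>cosh\<close>.\<close>
      using eventually_ge_at_top[of a]
    proof eventually_elim
      case (elim t)
      have "hilbert_dist (geodesic p y (- t)) x = t - a \<longleftrightarrow>
          g x + exp (- (2 * t)) * (A x - exp a / 2) = 0" if x: "x \<in> disc" for x
      proof -
        have "hilbert_dist (geodesic p y (- t)) x = t - a \<longleftrightarrow>
            cosh (hilbert_dist x (geodesic p y (- t))) = cosh (t - a)"
          using elim hilbert_dist_nonneg[OF x geo] hilbert_dist_commute[OF x geo]
          by simp
        also have "\<dots> \<longleftrightarrow> exp (- t) * A x + exp t * B x - cosh (t - a) = 0"
          by (simp add: cosh_eq[OF x])
        \<comment> \<open>Factoring out \<open>exp t\<close> separates the limit \<open>g\<close>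
          from a perturbation of size \<open>exp (- (2 * t))\<close>.\<close>
        also have "exp (- t) * A x + exp t * B x - cosh (t - a) =
            exp t * (g x + exp (- (2 * t)) * (A x - exp a / 2))"
        proof -
          have exps: "exp t * exp (- (2 * t)) = exp (- t)"
            "cosh (t - a) = (exp t * exp (- a) + exp (- t) * exp a) / 2"
            by (simp_all add: cosh_def flip: exp_add)
          have "exp t * (g x + exp (- (2 * t)) * (A x - exp a / 2)) =
              exp t * g x + (exp t * exp (- (2 * t))) * (A x - exp a / 2)"
            by (simp only: distrib_left mult.assoc)
          then show ?thesis
            unfolding exps g_def by (simp add: right_diff_distrib add_divide_distrib)
        qed
        finally show ?thesis by simp
      qed
      then show ?case
        unfolding forward_sphere_def by blast
    qed
    show "\<exists>u \<in> disc \<inter> ball x e. \<exists>v \<in> disc \<inter> ball x e. g u < 0 \<and> 0 < g v"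
      if x: "x \<in> disc" "g x = 0" and "e > 0" for x e
    proof -
      obtain u v where uv: "u \<in> disc \<inter> ball x e" "v \<in> disc \<inter> ball x e"
        "1 - u \<bullet> z < c * sqrt (1 - u \<bullet> u)" "c * sqrt (1 - v \<bullet> v) < 1 - v \<bullet> z"
        using horocycle_equation_sign_change[OF zz c x(1)] zero x \<open>e > 0\<close> by blast
      then have "u \<in> disc" "v \<in> disc"
        by blast+
      have "g u < 0"
        unfolding g_eq[OF \<open>u \<in> disc\<close>] using g_pos[OF \<open>u \<in> disc\<close>]
        by (rule mult_pos_neg) (use uv(3) in simp)
      moreover have "0 < g v"
        unfolding g_eq[OF \<open>v \<in> disc\<close>] using g_pos[OF \<open>v \<in> disc\<close>]
        by (rule mult_pos_pos) (use uv(4) in simp)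
      ultimately show ?thesis using uv(1,2) by blast
    qed
  qed (rule open_ball convex_ball)+
  have "backward_horocycle (geodesic p y) a = {x \<in> disc. g x = 0}"
    unfolding backward_horocycle_def
    by (rule the_equality, rule lim) (rule set_limit_in_unique[OF _ lim])
  also have "\<dots> = {x \<in> disc. 1 - x \<bullet> z = c * sqrt (1 - x \<bullet> x)}"
    by (rule Collect_cong) (use zero in \<open>simp cong: conj_cong\<close>)
  finally have "\<exists>E. is_ellipse E \<and> z \<in> E \<and> backward_horocycle (geodesic p y) a = E - {z}"
    using horocycle_equation_ellipse[OF zz c] by simp
  with forward show ?thesis
    unfolding z Let_def by blast
qed

end
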